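(* Let $\mathrm{ALG}$ be an order-oblivious $c$-competitive algorithm for a random-order batched online selection problem. Then the derived algorithm $\mathrm{ALG}'$ (defined in the context from $\mathrm{ALG}$) is a $c$-competitive algorithm for the same problem in the two-faced model.
   Context: An environment for a batched online selection problem is $\mathcal{E}=(\mathcal{U},\mathcal{P},\mathcal{J})$, where $\mathcal{U}=\{1,\dots,m\}$ is a universe of elements, $\mathcal{P}=\{P_1,\dots,P_n\}$ is a partition of $\mathcal{U}$ into $n$ disjoint subsets called items, and $\mathcal{J}\subseteq2^{\mathcal{U}}$ is the family of feasible sets. Given non-negative weights on the elements, the items are presented online one by one. When an item arrives, its elements and their weights are revealed, and the algorithm must immediately and irrevocably accept or reject each of its elements; the set of accepted elements must be in $\mathcal{J}$ at all times. $\mathrm{ALG}(\mathcal{I})$ is the total weight of accepted elements on instance $\mathcal{I}$; $\mathrm{OPT}(\mathcal{I})$ is the maximum weight of a set in $\mathcal{J}$ (under the online weights). Random-order model: the adversary chooses the weights $w$ and the items arrive in uniformly random order; $\mathcal{I}=(\mathcal{E},w)$. $c$-competitive: $\mathrm{E}[\mathrm{ALG}(\mathcal{I})]\ge c\cdot\mathrm{OPT}(\mathcal{I})$ for every instance. An algorithm in the random-order model is order-oblivious $c$-competitive if (1) it sets a (possibly random) integer $k$, collects the first $k$ arriving items (with their weights) into a sample, accepting none of their elements, and then uses information from the sample to make accept/reject decisions on later items; and (2) it is $c$-competitive when the first $k$ items are those of a uniformly random permutation, for any (possibly adversarial) arrival order of the remaining items after the sampling phase. Two-faced model: for each item $P_i$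 the adversary chooses a pair of weight vectors $f_{i,1},f_{i,2}$ for its elements. For each $i$, independently, $s_i\in\{f_{i,1},f_{i,2}\}$ is chosen uniformly at random and $w_i$ is the remaining vector. The items weighted by $s=(s_1,\dots,s_n)$ are given to the algorithm upfront; then the items weighted by $w=(w_1,\dots,w_n)$ arrive online in an adversarial order (which may depend on the realization of $s$ and $w$). With $\mathcal{I}=(\mathcal{E},f_1,f_2)$, an algorithm is $c$-competitive if $\mathrm{E}[\mathrm{ALG}(\mathcal{I})]\ge c\cdot\mathrm{E}[\mathrm{OPT}(\mathcal{I})]$ for every instance, with expectation over $s$ (and $w$) and the algorithm's internal randomness. The algorithm $\mathrm{ALG}'$. Offline stage: given the items weighted by $s$, let $k$ be the length of the sampling phase of $\mathrm{ALG}$, draw a uniformly random permutation $j_1,\dots,j_n$ of $\{1,\dots,n\}$, and pass $P_{j_1},\dots,P_{j_k}$ with weights $s_{j_1},\dots,s_{j_k}$ to $\mathrm{ALG}$ as its first $k$ items. Online stage: when an item $P_i$ with weights $w_i$ arrives, if $i\in\{j_1,\dots,j_k\}$ ignore it (accept nothing); otherwise pass $P_i$ with weights $w_i$ to $\mathrm{ALG}$ and accept/reject its elements exactly as $\mathrm{ALG}$ does. *)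

theory Defs
  imports "HOL-Probability.Probability" "HOL-Combinatorics.Multiset_Permutations"
begin

section \<open>Environments and instances\<close>

record env =
  num_elems :: nat
  num_items :: nat
  item :: "nat \<Rightarrow> nat set"
  feasible :: "nat set set"

abbreviation items :: "env \<Rightarrow> nat set" where
  "items E \<equiv> {1..num_items E}"

definition environment :: "env \<Rightarrow> bool" where
  "environment E \<longleftrightarrow>
     partition_on {1..num_elems E} (item E ` items E) \<and> inj_on (item E) (items E) \<and>
     feasible E \<subseteq> Pow {1..num_elems E}"

text \<open>A weighting assigns to every item \<open>i\<close> the vector \<open>w i\<close> of the non-negative weights of the
  elements of that item (and of nothing else, so that revealing \<open>w i\<close> reveals only these).\<close>

type_synonym weighting = "nat \<Rightarrow> nat \<Rightarrow> real"

definition weightings :: "env \<Rightarrow> weighting set" where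
  "weightings E = (\<Pi>\<^sub>E i\<in>items E. item E i \<rightarrow>\<^sub>E {0..})"

definition weight :: "env \<Rightarrow> weighting \<Rightarrow> nat set \<Rightarrow> real" where
  "weight E w A = (\<Sum>i\<in>items E. \<Sum>e\<in>A \<inter> item E i. w i e)"

text \<open>Only used when some algorithm is feasible for \<open>E\<close>; then \<open>{} \<in> feasible E\<close>, so that the
  maximum exists.\<close>

definition opt :: "env \<Rightarrow> weighting \<Rightarrow> real" where
  "opt E w = Max (weight E w ` feasible E)"


section \<open>Arrival sequences and online decisions\<close>

text \<open>An arrival consists of the index of the item and the weights of its elements.\<close>

type_synonym arrival = "nat \<times> (nat \<Rightarrow> real)"

definition arrivals :: "weighting \<Rightarrow> nat list \<Rightarrow> arrival list" where
  "arrivals w is = map (\<lambda>i. (i, w i)) is"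

definition history :: "env \<Rightarrow> arrival list \<Rightarrow> bool" where
  "history E h \<longleftrightarrow> distinct (map fst h) \<and>
     (\<forall>(i, v)\<in>set h. i \<in> items E \<and> v \<in> item E i \<rightarrow>\<^sub>E {0..})"

text \<open>A decision rule \<open>d\<close> maps the arrivals seen so far (the current one being the last in the
  list) to the set of elements of the current item that are accepted.\<close>

definition accepted :: "(arrival list \<Rightarrow> nat set) \<Rightarrow> arrival list \<Rightarrow> nat set" where
  "accepted d h = (\<Union>t\<in>{1..length h}. d (take t h))"


section \<open>The random-order model\<close>

text \<open>Internal randomness is a random seed, drawn once from an arbitrary probability space.\<close>

record 'r algorithm =
  seed :: "'r measure"
  accept :: "'r \<Rightarrow> arrival list \<Rightarrow> nat set"

text \<open>Every prefix of a history is a history, hence the last condition says that the set of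
  accepted elements is feasible at all times.\<close>

definition online_algorithm :: "env \<Rightarrow> ('r, 'x) algorithm_scheme \<Rightarrow> bool" where
  "online_algorithm E A \<longleftrightarrow> prob_space (seed A) \<and>
     (\<forall>h. history E h \<and> h \<noteq> [] \<longrightarrow>
        (\<lambda>\<omega>. accept A \<omega> h) \<in> seed A \<rightarrow>\<^sub>M count_space (Pow (item E (fst (last h))))) \<and>
     (\<forall>\<omega>\<in>space (seed A). \<forall>h. history E h \<longrightarrow> accepted (accept A \<omega>) h \<in> feasible E)"

record 'r sampling_algorithm = "'r algorithm" +
  sample_length :: "'r \<Rightarrow> nat"

definition sampling_algorithm :: "env \<Rightarrow> 'r sampling_algorithm \<Rightarrow> bool" where
  "sampling_algorithm E A \<longleftrightarrow> online_algorithm E A \<and>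
     sample_length A \<in> seed A \<rightarrow>\<^sub>M count_space {0..num_items E} \<and>
     (\<forall>\<omega>\<in>space (seed A). \<forall>h. history E h \<and> h \<noteq> [] \<and> length h \<le> sample_length A \<omega> \<longrightarrow>
        accept A \<omega> h = {})"

definition random_order :: "env \<Rightarrow> nat list measure" where
  "random_order E = uniform_count_measure (permutations_of_set (items E))"

text \<open>The adversary fixes the weights and, knowing which items were sampled, the arrival order
  \<open>adv K\<close> of the items outside the sample \<open>K\<close>. The random permutation \<open>js\<close> only determines the
  sampling phase, and it is independent of the seed.\<close>

definition order_oblivious_competitive_on :: "real \<Rightarrow> env \<Rightarrow> 'r sampling_algorithm \<Rightarrow> bool" where
  "order_oblivious_competitive_on c E A \<longleftrightarrow> sampling_algorithm E A \<and>
     (\<forall>w\<in>weightings E. \<forall>adv :: nat set \<Rightarrow> nat list.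
        (\<forall>K\<subseteq>items E. adv K \<in> permutations_of_set (items E - K)) \<longrightarrow>
        (\<integral>(\<omega>, js). (let sample = take (sample_length A \<omega>) js in
             weight E w (accepted (accept A \<omega>) (arrivals w (sample @ adv (set sample)))))
           \<partial>(seed A \<Otimes>\<^sub>M random_order E))
        \<ge> c * opt E w)"

text \<open>A batched online selection problem is given by the set \<open>Es\<close> of its environments. An
  algorithm for it knows the environment, i.e. it is a function of the environment.\<close>

definition order_oblivious_competitive ::
    "real \<Rightarrow> env set \<Rightarrow> (env \<Rightarrow> 'r sampling_algorithm) \<Rightarrow> bool" where
  "order_oblivious_competitive c Es ALG \<longleftrightarrow>
     (\<forall>E\<in>Es. order_oblivious_competitive_on c E (ALG E))"


section \<open>The two-faced model\<close>

text \<open>The decisions additionally depend on the weighting \<open>s\<close> given upfront.\<close>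

record 'r two_faced_algorithm =
  tf_seed :: "'r measure"
  tf_accept :: "'r \<Rightarrow> weighting \<Rightarrow> arrival list \<Rightarrow> nat set"

definition two_faced_algorithm :: "env \<Rightarrow> 'r two_faced_algorithm \<Rightarrow> bool" where
  "two_faced_algorithm E A \<longleftrightarrow>
     (\<forall>s\<in>weightings E. online_algorithm E \<lparr>seed = tf_seed A, accept = (\<lambda>\<omega>. tf_accept A \<omega> s)\<rparr>)"

definition coins :: "env \<Rightarrow> (nat \<Rightarrow> bool) pmf" where
  "coins E = Pi_pmf (items E) False (\<lambda>_. bernoulli_pmf (1/2))"

definition face_up :: "env \<Rightarrow> weighting \<Rightarrow> weighting \<Rightarrow> (nat \<Rightarrow> bool) \<Rightarrow> weighting" where
  "face_up E f1 f2 b = (\<lambda>i\<in>items E. if b i then f1 i else f2 i)"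

definition face_down :: "env \<Rightarrow> weighting \<Rightarrow> weighting \<Rightarrow> (nat \<Rightarrow> bool) \<Rightarrow> weighting" where
  "face_down E f1 f2 b = (\<lambda>i\<in>items E. if b i then f2 i else f1 i)"

text \<open>Here \<open>s\<close> consists of the faces that are up, and \<open>w\<close> of the remaining ones. The adversarial
  order \<open>adv s w\<close> depends on both, but not on the seed of the algorithm.\<close>

definition two_faced_competitive_on :: "real \<Rightarrow> env \<Rightarrow> 'r two_faced_algorithm \<Rightarrow> bool" where
  "two_faced_competitive_on c E A \<longleftrightarrow> two_faced_algorithm E A \<and>
     (\<forall>f1\<in>weightings E. \<forall>f2\<in>weightings E. \<forall>adv :: weighting \<Rightarrow> weighting \<Rightarrow> nat list.
        (\<forall>s w. adv s w \<in> permutations_of_set (items E)) \<longrightarrow>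
        (\<integral>(\<omega>, b). (let s = face_up E f1 f2 b; w = face_down E f1 f2 b in
             weight E w (accepted (tf_accept A \<omega> s) (arrivals w (adv s w))))
           \<partial>(tf_seed A \<Otimes>\<^sub>M measure_pmf (coins E)))
        \<ge> c * (\<integral>b. opt E (face_down E f1 f2 b) \<partial>measure_pmf (coins E)))"

definition two_faced_competitive ::
    "real \<Rightarrow> env set \<Rightarrow> (env \<Rightarrow> 'r two_faced_algorithm) \<Rightarrow> bool" where
  "two_faced_competitive c Es ALG \<longleftrightarrow> (\<forall>E\<in>Es. two_faced_competitive_on c E (ALG E))"


section \<open>The derived algorithm\<close>

text \<open>Its seed consists of a seed of the given algorithm and an independent random permutation.\<close>

definition derived_algorithm ::
    "(env \<Rightarrow> 'r sampling_algorithm) \<Rightarrow> env \<Rightarrow> ('r \<times> nat list) two_faced_algorithm" where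
  "derived_algorithm ALG E =
     \<lparr>tf_seed = seed (ALG E) \<Otimes>\<^sub>M random_order E,
      tf_accept = (\<lambda>(\<omega>, js) s h.
        let sample = take (sample_length (ALG E) \<omega>) js in
        if fst (last h) \<in> set sample then {}
        else accept (ALG E) \<omega>
               (arrivals s sample @ filter (\<lambda>a. fst a \<notin> set sample) h))\<rparr>"

end

theory Submission
  imports Defs
begin

text \<open>Given the sample \<open>K\<close>, flip the coins of the items in \<open>K\<close>. This preserves the distribution
  of the coins for each fixed \<open>K\<close>, so the flipped coins are independent of the seed and of the
  permutation. In terms of the flipped coins the derived algorithm runs the given one on the single
  weighting \<open>u\<close> that the sampling phase and the online phase reveal together, and the order of
  the items outside \<open>K\<close> is a function of the flipped coins and \<open>K\<close>. Hence order-obliviousness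
  applies conditionally on the flipped coins, and \<open>u\<close> has the same distribution as the online
  weighting.\<close>

section \<open>Items and bounds on weights\<close>

lemma item_unique:
  assumes "environment E" "i \<in> items E" "j \<in> items E" "e \<in> item E i" "e \<in> item E j"
  shows "i = j"
proof -
  have "disjoint (item E ` items E)" "inj_on (item E) (items E)"
    using assms(1) by (auto simp: environment_def partition_on_def)
  moreover have "item E i \<inter> item E j \<noteq> {}"
    using assms(4,5) by blast
  ultimately show ?thesis
    using disjointD[of "item E ` items E" "item E i" "item E j"] inj_onD[of "item E" "items E" i j]
      assms(2,3) by blast
qed

lemma finite_item:
  assumes "environment E" "i \<in> items E"
  shows "finite (item E i)"
proof -
  have "item E i \<subseteq> {1..num_elems E}"
    using assms by (auto simp: environment_def partition_on_def)
  then show ?thesis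
    using finite_subset by blast
qed

lemma weightings_nonneg:
  assumes "w \<in> weightings E" "i \<in> items E" "e \<in> item E i"
  shows "0 \<le> w i e"
proof -
  have "w i \<in> item E i \<rightarrow>\<^sub>E {0..}"
    using assms(1,2) unfolding weightings_def by (rule PiE_mem)
  then show ?thesis
    using assms(3) by (auto dest: PiE_mem)
qed

lemma weight_nonneg:
  assumes "w \<in> weightings E"
  shows "0 \<le> weight E w A"
  unfolding weight_def by (intro sum_nonneg) (simp add: weightings_nonneg[OF assms])

text \<open>With sums over whole items, \<open>A\<close> enters only through the indicators of its
  elements. This gives the comparison with \<open>UNIV\<close> and, for a random set
  \<open>A\<close>, measurability.\<close>

lemma weight_eq_sum_indicator:
  assumes "environment E"
  shows "weight E w A = (\<Sum>i\<in>items E. \<Sum>e\<in>item E i. if e \<in> A then w i e else 0)"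
  unfolding weight_def
proof (rule sum.cong[OF refl])
  fix i assume "i \<in> items E"
  then show "(\<Sum>e\<in>A \<inter> item E i. w i e) = (\<Sum>e\<in>item E i. if e \<in> A then w i e else 0)"
    using sum.inter_restrict[OF finite_item[OF assms], of i "w i" A]
    by (simp add: Int_commute)
qed

text \<open>As \<open>weight\<close> only sees elements of items, \<open>UNIV\<close> stands for the
  total weight. The bound does not depend on the accepted set and later yields
  integrability.\<close>

lemma weight_le_weight_UNIV:
  assumes "environment E" "w \<in> weightings E"
  shows "weight E w A \<le> weight E w UNIV"
  unfolding weight_eq_sum_indicator[OF assms(1)]
  by (intro sum_mono) (simp add: weightings_nonneg[OF assms(2)])

section \<open>Histories and accepted sets\<close>

lemma history_Nil [simp]: "history E []"
  by (simp add: history_def)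

lemma history_take:
  assumes "history E h"
  shows "history E (take t h)"
  using assms unfolding history_def
  by (simp flip: take_map) (blast dest: in_set_takeD)

lemma history_append_iff:
  "history E (g @ h) \<longleftrightarrow> history E g \<and> history E h \<and> fst ` set g \<inter> fst ` set h = {}"
  unfolding history_def map_append distinct_append set_append ball_Un set_map by blast

lemma history_filter:
  assumes "history E h"
  shows "history E (filter P h)"
  using assms unfolding history_def by (simp add: distinct_map_filter)

lemma history_arrivals:
  assumes "w \<in> weightings E" "distinct is" "set is \<subseteq> items E"
  shows "history E (arrivals w is)"
  using assms PiE_mem[of w "items E" "\<lambda>i. item E i \<rightarrow>\<^sub>E {0..}"]
  unfolding history_def arrivals_def weightings_def
  by (simp add: o_def subset_iff)

lemma fst_set_arrivals [simp]: "fst ` set (arrivals w is) = set is"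
  by (simp add: arrivals_def image_image)

lemma accepted_Nil [simp]: "accepted d [] = {}"
  by (simp add: accepted_def)

lemma accepted_snoc [simp]: "accepted d (h @ [a]) = accepted d h \<union> d (h @ [a])"
proof -
  have "{1..length (h @ [a])} = insert (Suc (length h)) {1..length h}"
    by auto
  then show ?thesis
    unfolding accepted_def by auto
qed

lemma measurable_accept:
  assumes "online_algorithm E A" "history E h" "h \<noteq> []"
  shows "(\<lambda>\<omega>. accept A \<omega> h) \<in> seed A \<rightarrow>\<^sub>M count_space (Pow (item E (fst (last h))))"
  using assms unfolding online_algorithm_def by blast

lemma accept_subset_item:
  assumes "online_algorithm E A" "\<omega> \<in> space (seed A)" "history E h" "h \<noteq> []"
  shows "accept A \<omega> h \<subseteq> item E (fst (last h))"
  using measurable_space[OF measurable_accept[OF assms(1,3,4)] assms(2)] by simp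

text \<open>For a fixed history the weight is a finite sum over elements \<open>e\<close>, and
  "\<open>e\<close> is accepted" is a finite union, over the nonempty prefixes, of events about a
  single decision.\<close>

lemma measurable_weight_accepted:
  assumes "environment E" "online_algorithm E A" "history E h"
  shows "(\<lambda>\<omega>. weight E w (accepted (accept A \<omega>) h)) \<in> borel_measurable (seed A)"
proof -
  have [measurable]: "Measurable.pred (seed A) (\<lambda>\<omega>. e \<in> accepted (accept A \<omega>) h)" for e
  proof -
    have "Measurable.pred (seed A) (\<lambda>\<omega>. e \<in> accept A \<omega> (take t h))" if "t \<in> {1..length h}" for t
    proof -
      have "take t h \<noteq> []"
        using that by auto
      then have "(\<lambda>\<omega>. accept A \<omega> (take t h)) \<in>
          seed A \<rightarrow>\<^sub>M count_space (Pow (item E (fst (last (take t h)))))"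
        by (rule measurable_accept[OF assms(2) history_take[OF assms(3)]])
      from measurable_compose[OF this, of "\<lambda>B. e \<in> B" "count_space UNIV"] show ?thesis
        by simp
    qed
    then show ?thesis
      unfolding accepted_def UN_iff by (intro pred_intros_finite) auto
  qed
  show ?thesis
    unfolding weight_eq_sum_indicator[OF assms(1)] by measurable
qed

section \<open>The sample and the simulated run\<close>

lemma space_random_order [simp]: "space (random_order E) = permutations_of_set (items E)"
  by (simp add: random_order_def space_uniform_count_measure)

lemma sets_random_order: "sets (random_order E) = sets (count_space (permutations_of_set (items E)))"
  by (simp add: random_order_def sets_uniform_count_measure)

lemma prob_space_random_order: "prob_space (random_order E)"
  unfolding random_order_def by (intro prob_space_uniform_count_measure) auto

text \<open>The pair takes finitely many values, so whatever depends on the sample can be shown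
  measurable one value at a time.\<close>

lemma measurable_sample_perm:
  assumes "sampling_algorithm E A"
  shows "(\<lambda>(\<omega>, js). (sample_length A \<omega>, js)) \<in>
    seed A \<Otimes>\<^sub>M random_order E \<rightarrow>\<^sub>M count_space ({0..num_items E} \<times> permutations_of_set (items E))"
proof -
  have [measurable]: "sample_length A \<in> seed A \<rightarrow>\<^sub>M count_space {0..num_items E}"
    using assms by (simp add: sampling_algorithm_def)
  have [measurable]: "id \<in> random_order E \<rightarrow>\<^sub>M count_space (permutations_of_set (items E))"
    unfolding id_def by (rule measurable_ident_sets[OF sets_random_order])
  have "(\<lambda>x. (sample_length A (fst x), id (snd x))) \<in> seed A \<Otimes>\<^sub>M random_order E \<rightarrow>\<^sub>M
      count_space {0..num_items E} \<Otimes>\<^sub>M count_space (permutations_of_set (items E))"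
    by measurable
  then show ?thesis
    by (simp add: pair_measure_count_space case_prod_beta)
qed

text \<open>An arrival of a sampled item changes neither side; any other arrival extends the
  simulated history by one entry, on which both sides take the same decision. The sampling phase
  itself contributes nothing.\<close>

lemma accepted_derived:
  assumes "sampling_algorithm E (ALG E)" "s \<in> weightings E"
    and "\<omega> \<in> space (seed (ALG E))" "js \<in> permutations_of_set (items E)"
  defines "sample \<equiv> take (sample_length (ALG E) \<omega>) js"
  shows "accepted (tf_accept (derived_algorithm ALG E) (\<omega>, js) s) h =
    accepted (accept (ALG E) \<omega>) (arrivals s sample @ filter (\<lambda>a. fst a \<notin> set sample) h)"
proof (induction h rule: rev_induct)
  case Nil
  have "history E (arrivals s sample)"
    using assms(2,4) unfolding sample_def
    by (intro history_arrivals) (auto simp: permutations_of_set_def dest: in_set_takeD)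
  then have history: "history E (take t (arrivals s sample))" for t
    by (rule history_take)
  have reject: "accept (ALG E) \<omega> g = {}"
    if "history E g" "g \<noteq> []" "length g \<le> sample_length (ALG E) \<omega>" for g
    using assms(1,3) that unfolding sampling_algorithm_def by blast
  \<comment> \<open>The sample has at most \<open>sample_length\<close> entries, so each of its
    prefixes still lies in the sampling phase.\<close>
  have "accept (ALG E) \<omega> (take t (arrivals s sample)) = {}"
    if "t \<in> {1..length (arrivals s sample)}" for t
    by (rule reject[OF history]) (use that in \<open>auto simp: arrivals_def sample_def\<close>)
  then have "accepted (accept (ALG E) \<omega>) (arrivals s sample) = {}"
    unfolding accepted_def by blast
  then show ?case
    by simp
next
  case (snoc a h)
  have run: "tf_accept (derived_algorithm ALG E) (\<omega>, js) s (h @ [a]) =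
      (if fst a \<in> set sample then {} else accept (ALG E) \<omega>
        (arrivals s sample @ filter (\<lambda>a. fst a \<notin> set sample) (h @ [a])))"
    by (simp add: derived_algorithm_def Let_def sample_def)
  show ?case
  proof (cases "fst a \<in> set sample")
    case True
    then show ?thesis
      unfolding accepted_snoc run by (simp add: snoc.IH)
  next
    case False
    then have "filter (\<lambda>a. fst a \<notin> set sample) (h @ [a]) =
        filter (\<lambda>a. fst a \<notin> set sample) h @ [a]"
      by simp
    with False show ?thesis
      unfolding accepted_snoc run by (simp only: snoc.IH append_assoc[symmetric] accepted_snoc if_False)
  qed
qed

text \<open>Removing the sampled items from the online arrivals ensures that no item occurs twice in
  the simulated history. Feasibility is then inherited from the given algorithm through
  \<open>accepted_derived\<close>.\<close>

lemma two_faced_algorithm_derived: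
  assumes "sampling_algorithm E (ALG E)"
  shows "two_faced_algorithm E (derived_algorithm ALG E)"
  unfolding two_faced_algorithm_def
proof
  fix s assume s: "s \<in> weightings E"
  let ?M = "seed (ALG E) \<Otimes>\<^sub>M random_order E"
  let ?A = "derived_algorithm ALG E"
  let ?ext = "\<lambda>sample h. arrivals s sample @ filter (\<lambda>a. fst a \<notin> set sample) h"
  have online: "online_algorithm E (ALG E)"
    using assms by (simp add: sampling_algorithm_def)
  have ext: "history E (?ext (take k js) h)"
    if "history E h" "js \<in> permutations_of_set (items E)" for k js h
    unfolding history_append_iff
  proof (intro conjI)
    show "history E (arrivals s (take k js))"
      using s that(2) by (intro history_arrivals) (auto simp: permutations_of_set_def dest: in_set_takeD)
    show "history E (filter (\<lambda>a. fst a \<notin> set (take k js)) h)"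
      using that(1) by (rule history_filter)
    show "fst ` set (arrivals s (take k js)) \<inter> fst ` set (filter (\<lambda>a. fst a \<notin> set (take k js)) h) = {}"
      unfolding fst_set_arrivals set_filter by blast
  qed
  have "(\<lambda>x. tf_accept ?A x s h) \<in> ?M \<rightarrow>\<^sub>M count_space (Pow (item E (fst (last h))))"
    if h: "history E h" "h \<noteq> []" for h
  proof -
    \<comment> \<open>\<open>?f\<close> freezes the sample length and the permutation, so that the
      simulated history is fixed and only the seed remains random.\<close>
    let ?f = "\<lambda>(k, js) (\<omega>, js' :: nat list). if fst (last h) \<in> set (take k js) then {}
      else accept (ALG E) \<omega> (?ext (take k js) h)"
    have "?f p \<in> ?M \<rightarrow>\<^sub>M count_space (Pow (item E (fst (last h))))"
      if pmem: "p \<in> {0..num_items E} \<times> permutations_of_set (items E)" for p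
    proof -
      obtain k js where p: "p = (k, js)" "js \<in> permutations_of_set (items E)"
        using pmem by blast
      show ?thesis
      proof (cases "fst (last h) \<in> set (take k js)")
        case True
        then show ?thesis by (simp add: p(1) case_prod_unfold)
      next
        case False
        \<comment> \<open>The current item is not sampled and survives the filter, so the given
          algorithm decides on the elements of that same item.\<close>
        then have "?ext (take k js) h \<noteq> []" "last (?ext (take k js) h) = last h"
          using h(2) by (cases h rule: rev_cases; simp)+
        then have "(\<lambda>\<omega>. accept (ALG E) \<omega> (?ext (take k js) h)) \<in>
            seed (ALG E) \<rightarrow>\<^sub>M count_space (Pow (item E (fst (last h))))"
          using measurable_accept[OF online ext[OF h(1) p(2), of k]] by simp
        from measurable_compose[OF measurable_fst this] show ?thesis
          using False by (simp add: p(1) case_prod_unfold)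
      qed
    qed
    then have "(\<lambda>x. ?f ((\<lambda>(\<omega>, js). (sample_length (ALG E) \<omega>, js)) x) x)
        \<in> ?M \<rightarrow>\<^sub>M count_space (Pow (item E (fst (last h))))"
      by (rule measurable_compose_countable'[OF _ measurable_sample_perm[OF assms]])
        (auto intro: countable_finite)
    moreover have "tf_accept ?A x s h = ?f ((\<lambda>(\<omega>, js). (sample_length (ALG E) \<omega>, js)) x) x" for x
      by (cases x) (simp add: derived_algorithm_def Let_def)
    ultimately show ?thesis
      by presburger
  qed
  moreover have "accepted (tf_accept ?A x s) h \<in> feasible E"
    if "x \<in> space ?M" "history E h" for x h
  proof -
    obtain \<omega> js where x: "x = (\<omega>, js)" "\<omega> \<in> space (seed (ALG E))"
        "js \<in> permutations_of_set (items E)"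
      using \<open>x \<in> space ?M\<close> by (auto simp: space_pair_measure)
    show ?thesis
      unfolding x(1) accepted_derived[where ALG = ALG, OF assms s x(2,3)]
      using online x(2) ext[OF that(2) x(3)] unfolding online_algorithm_def by blast
  qed
  moreover have "prob_space ?M"
  proof -
    interpret prob_space "seed (ALG E)"
      using online by (simp add: online_algorithm_def)
    interpret R: prob_space "random_order E"
      by (rule prob_space_random_order)
    interpret pair_prob_space "seed (ALG E)" "random_order E" ..
    show ?thesis
      by (rule P.prob_space_axioms)
  qed
  ultimately show
    "online_algorithm E \<lparr>seed = tf_seed ?A, accept = (\<lambda>x. tf_accept ?A x s)\<rparr>"
    unfolding online_algorithm_def by (simp add: derived_algorithm_def del: Pow_iff)
qed

section \<open>Flipping the coins of the sampled items\<close>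

definition flip :: "nat set \<Rightarrow> (nat \<Rightarrow> bool) \<Rightarrow> nat \<Rightarrow> bool" where
  "flip K b = (\<lambda>i. if i \<in> K then \<not> b i else b i)"

lemma flip_flip [simp]: "flip K (flip K b) = b"
  by (auto simp: flip_def)

lemma pmf_coins:
  "pmf (coins E) b = (if \<forall>i. i \<notin> items E \<longrightarrow> \<not> b i then (1/2) ^ num_items E else 0)"
proof -
  have "pmf (bernoulli_pmf (1/2)) x = 1/2" for x
    by (cases x) auto
  then show ?thesis
    by (simp add: coins_def pmf_Pi del: atLeastAtMost_iff) blast
qed

text \<open>The flip is an involution, and all configurations that are \<open>False\<close> outside
  the items have equal mass. Since \<open>K\<close> consists of items, the default value outside is
  untouched.\<close>

lemma map_pmf_flip_coins:
  assumes "K \<subseteq> items E"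
  shows "map_pmf (flip K) (coins E) = coins E"
proof (rule pmf_eqI)
  fix b
  have "inj (flip K)"
    by (metis flip_flip injI)
  then have "pmf (map_pmf (flip K) (coins E)) (flip K (flip K b)) = pmf (coins E) (flip K b)"
    by (rule pmf_map_inj')
  also have "\<dots> = pmf (coins E) b"
    using assms unfolding pmf_coins flip_def by (intro if_cong) auto
  finally show "pmf (map_pmf (flip K) (coins E)) b = pmf (coins E) b"
    by simp
qed

lemma finite_set_pmf_coins: "finite (set_pmf (coins E))"
  unfolding coins_def
  by (rule finite_subset[OF set_Pi_pmf_subset']) (auto intro: finite_PiE_dflt)

lemma face_in_weightings:
  assumes "f1 \<in> weightings E" "f2 \<in> weightings E"
  shows "face_up E f1 f2 b \<in> weightings E" "face_down E f1 f2 b \<in> weightings E"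
  using assms by (auto simp: weightings_def face_up_def face_down_def PiE_iff)

text \<open>This locality reduces the uncountable space of coin functions to finitely many relevant
  patterns.\<close>

lemma face_cong:
  assumes "\<And>i. i \<in> items E \<Longrightarrow> b i = b' i"
  shows "face_up E f1 f2 b = face_up E f1 f2 b'" "face_down E f1 f2 b = face_down E f1 f2 b'"
  using assms by (auto simp: face_up_def face_down_def intro!: restrict_ext)

lemma face_flip:
  assumes "i \<in> items E"
  shows "i \<in> K \<Longrightarrow> face_up E f1 f2 (flip K b) i = face_down E f1 f2 b i"
    and "i \<notin> K \<Longrightarrow> face_down E f1 f2 (flip K b) i = face_down E f1 f2 b i"
  using assms by (auto simp: face_up_def face_down_def flip_def)

text \<open>By \<open>face_flip\<close>, \<open>u\<close> agrees with \<open>s\<close> on the sample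
  and with \<open>w\<close> off it, so the simulated history is an arrival sequence of
  \<open>u\<close> alone. Measuring by \<open>w\<close> or by \<open>u\<close> makes no difference,
  as the two differ only on sampled items, from which nothing is accepted.\<close>

lemma two_faced_run_flip:
  fixes E ALG \<omega> js f1 f2 b "is"
  assumes env: "environment E" and samp: "sampling_algorithm E (ALG E)"
    and f: "f1 \<in> weightings E" "f2 \<in> weightings E"
    and \<omega>: "\<omega> \<in> space (seed (ALG E))" and js: "js \<in> permutations_of_set (items E)"
    and "is": "is \<in> permutations_of_set (items E)"
  defines "sample \<equiv> take (sample_length (ALG E) \<omega>) js"
  defines "s \<equiv> face_up E f1 f2 (flip (set sample) b)"
    and "w \<equiv> face_down E f1 f2 (flip (set sample) b)"
    and "u \<equiv> face_down E f1 f2 b"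
  shows "weight E w (accepted (tf_accept (derived_algorithm ALG E) (\<omega>, js) s) (arrivals w is)) =
    weight E u (accepted (accept (ALG E) \<omega>)
      (arrivals u (sample @ filter (\<lambda>i. i \<notin> set sample) is)))"
proof -
  let ?A = "derived_algorithm ALG E"
  let ?acc = "accepted (tf_accept ?A (\<omega>, js) s) (arrivals w is)"
  have sw: "s \<in> weightings E" "w \<in> weightings E"
    unfolding s_def w_def using face_in_weightings[OF f] by auto
  have sub: "set sample \<subseteq> items E" "set is = items E" "distinct is"
    using js "is" by (auto simp: sample_def permutations_of_set_def dest: in_set_takeD)
  have "arrivals s sample = arrivals u sample"
    using sub(1) by (auto simp: arrivals_def s_def u_def face_flip(1))
  moreover have "filter (\<lambda>a. fst a \<notin> set sample) (arrivals w is) =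
      arrivals u (filter (\<lambda>i. i \<notin> set sample) is)"
    using sub(2) by (auto simp: arrivals_def filter_map o_def w_def u_def face_flip(2))
  ultimately have run: "?acc = accepted (accept (ALG E) \<omega>)
      (arrivals u (sample @ filter (\<lambda>i. i \<notin> set sample) is))"
    using accepted_derived[where ALG = ALG, OF samp sw(1) \<omega> js]
    by (simp add: sample_def[symmetric]) (simp add: arrivals_def)
  \<comment> \<open>Each decision accepts only elements of the current item. Items are disjoint, so
    an element of item \<open>i\<close> could only be accepted when \<open>i\<close> itself arrives,
    and then it is ignored.\<close>
  have disj: "?acc \<inter> item E i = {}" if i: "i \<in> set sample" for i
  proof (rule ccontr)
    assume "?acc \<inter> item E i \<noteq> {}"
    then obtain e t where e: "e \<in> item E i" "t \<in> {1..length (arrivals w is)}"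
        "e \<in> tf_accept ?A (\<omega>, js) s (take t (arrivals w is))"
      unfolding accepted_def by blast
    let ?h = "take t (arrivals w is)"
    have h: "history E ?h" "?h \<noteq> []"
      using e(2) sub sw(2) by (auto intro!: history_take history_arrivals)
    have "online_algorithm E \<lparr>seed = tf_seed ?A, accept = (\<lambda>x. tf_accept ?A x s)\<rparr>"
      using two_faced_algorithm_derived[where ALG = ALG, OF samp] sw(1) by (simp add: two_faced_algorithm_def)
    from accept_subset_item[OF this, of "(\<omega>, js)" ?h] have "e \<in> item E (fst (last ?h))"
      using e(3) h \<omega> js by (auto simp: derived_algorithm_def space_pair_measure)
    moreover have "fst (last ?h) \<in> items E"
      using h(1) last_in_set[OF h(2)] unfolding history_def by (cases "last ?h") auto
    ultimately have "fst (last ?h) = i"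
      using item_unique[OF env] e(1) i sub(1) by blast
    then have "tf_accept ?A (\<omega>, js) s ?h = {}"
      using i by (simp add: derived_algorithm_def Let_def sample_def)
    then show False
      using e(3) by simp
  qed
  have "weight E w ?acc = weight E u ?acc"
    unfolding weight_def
  proof (intro sum.cong refl)
    fix i e assume "i \<in> items E" "e \<in> ?acc \<inter> item E i"
    then have "i \<notin> set sample"
      using disj by blast
    then show "w i e = u i e"
      using \<open>i \<in> items E\<close> by (simp add: w_def u_def face_flip(2))
  qed
  then show ?thesis
    by (simp add: run)
qed

text \<open>The coin functions form an uncountable discrete space, so measurability for each fixed
  \<open>b\<close> is not enough by itself. Locality lets \<open>b\<close> be replaced by its normal
  form \<open>?r b\<close>, which ranges over the finite set \<open>?B\<close>.\<close>

lemma borel_measurable_pair_coins: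
  fixes F :: "'a \<Rightarrow> (nat \<Rightarrow> bool) \<Rightarrow> real"
  assumes "\<And>b. (\<lambda>x. F x b) \<in> borel_measurable M"
    and local: "\<And>x b b'. (\<And>i. i \<in> items E \<Longrightarrow> b i = b' i) \<Longrightarrow> F x b = F x b'"
  shows "(\<lambda>(x, b). F x b) \<in> borel_measurable (M \<Otimes>\<^sub>M measure_pmf (coins E))"
proof -
  let ?r = "\<lambda>b i. i \<in> items E \<and> b i"
  let ?B = "PiE_dflt (items E) False (\<lambda>_. UNIV)"
  have "countable ?B"
    by (intro countable_finite finite_PiE_dflt) auto
  have "(\<lambda>x. ?r (snd x)) \<in> M \<Otimes>\<^sub>M measure_pmf (coins E) \<rightarrow>\<^sub>M count_space ?B"
    by (rule measurable_compose[OF measurable_snd]) (auto simp: PiE_dflt_def)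
  moreover have "(\<lambda>x. F (fst x) b) \<in> borel_measurable (M \<Otimes>\<^sub>M measure_pmf (coins E))" for b
    using measurable_compose[OF measurable_fst assms(1)] .
  ultimately have "(\<lambda>x. F (fst x) (?r (snd x))) \<in> borel_measurable (M \<Otimes>\<^sub>M measure_pmf (coins E))"
    using measurable_compose_countable'[where f = "\<lambda>b x. F (fst x) b" and g = "\<lambda>x. ?r (snd x)"
        and I = ?B, OF _ _ \<open>countable ?B\<close>] by blast
  moreover have "F x (?r b) = F x b" for x b
    by (rule local) auto
  ultimately show ?thesis
    by (simp add: case_prod_unfold)
qed

text \<open>\<open>K x\<close> does not depend on the coins. Hence, with the coins integrated
  innermost, the flip is by a constant set and preserves their distribution; Fubini then moves the
  coins outside.\<close>

lemma integral_flip_coins: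
  fixes F :: "'a \<Rightarrow> (nat \<Rightarrow> bool) \<Rightarrow> real"
  assumes "prob_space M"
    and K: "K \<in> M \<rightarrow>\<^sub>M count_space (Pow (items E))"
    and meas: "\<And>b. (\<lambda>x. F x b) \<in> borel_measurable M"
    and local: "\<And>x b b'. (\<And>i. i \<in> items E \<Longrightarrow> b i = b' i) \<Longrightarrow> F x b = F x b'"
    and bound: "\<And>x b. \<bar>F x b\<bar> \<le> C"
  shows "(\<integral>(x, b). F x b \<partial>(M \<Otimes>\<^sub>M measure_pmf (coins E))) =
    (\<integral>b. (\<integral>x. F x (flip (K x) b) \<partial>M) \<partial>measure_pmf (coins E))"
proof -
  interpret prob_space M by fact
  interpret pair_prob_space M "measure_pmf (coins E)" ..
  let ?G = "\<lambda>x b. F x (flip (K x) b)"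
  \<comment> \<open>For each of the finitely many values \<open>L\<close> of \<open>K x\<close>, the
    coins \<open>flip L b\<close> are fixed and \<open>meas\<close> applies.\<close>
  have "(\<lambda>x. ?G x b) \<in> borel_measurable M" for b
    using measurable_compose_countable'[OF _ K, of "\<lambda>L x. F x (flip L b)"] meas
    by (simp add: countable_finite)
  moreover have "?G x b = ?G x b'" if "\<And>i. i \<in> items E \<Longrightarrow> b i = b' i" for x b b'
    by (rule local) (simp add: flip_def that)
  ultimately have G: "(\<lambda>(x, b). ?G x b) \<in> borel_measurable (M \<Otimes>\<^sub>M measure_pmf (coins E))"
    by (rule borel_measurable_pair_coins)
  have F: "(\<lambda>(x, b). F x b) \<in> borel_measurable (M \<Otimes>\<^sub>M measure_pmf (coins E))"
    using meas local by (rule borel_measurable_pair_coins)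
  have int: "integrable (M \<Otimes>\<^sub>M measure_pmf (coins E)) (\<lambda>(x, b). F x b)"
      "integrable (M \<Otimes>\<^sub>M measure_pmf (coins E)) (\<lambda>(x, b). ?G x b)"
    by (rule P.integrable_const_bound[OF _ F, of C] P.integrable_const_bound[OF _ G, of C],
        simp add: bound case_prod_unfold)+
  have "(\<integral>(x, b). F x b \<partial>(M \<Otimes>\<^sub>M measure_pmf (coins E))) =
      (\<integral>x. (\<integral>b. F x b \<partial>measure_pmf (coins E)) \<partial>M)"
    using integral_fst[OF int(1)] by simp
  also have "\<dots> = (\<integral>x. (\<integral>b. ?G x b \<partial>measure_pmf (coins E)) \<partial>M)"
  proof (rule Bochner_Integration.integral_cong[OF refl])
    fix x assume "x \<in> space M"
    then have "K x \<subseteq> items E"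
      using measurable_space[OF K] by auto
    then show "(\<integral>b. F x b \<partial>measure_pmf (coins E)) = (\<integral>b. ?G x b \<partial>measure_pmf (coins E))"
      using integral_map_pmf[of "flip (K x)" "coins E" "F x"] by (simp add: map_pmf_flip_coins)
  qed
  also have "\<dots> = (\<integral>b. (\<integral>x. ?G x b \<partial>M) \<partial>measure_pmf (coins E))"
    using Fubini_integral[OF int(2)] by simp
  finally show ?thesis .
qed

section \<open>Competitiveness in the two-faced model\<close>

lemma two_faced_competitive_on_derived:
  assumes env: "environment E" and comp: "order_oblivious_competitive_on c E (ALG E)"
  shows "two_faced_competitive_on c E (derived_algorithm ALG E)"
  unfolding two_faced_competitive_on_def
proof (intro conjI ballI allI impI)
  have samp: "sampling_algorithm E (ALG E)"
    using comp by (simp add: order_oblivious_competitive_on_def)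
  then show tf: "two_faced_algorithm E (derived_algorithm ALG E)"
    by (rule two_faced_algorithm_derived)
  fix f1 f2 and adv :: "weighting \<Rightarrow> weighting \<Rightarrow> nat list"
  assume f: "f1 \<in> weightings E" "f2 \<in> weightings E"
    and adv: "\<forall>s w. adv s w \<in> permutations_of_set (items E)"
  let ?A = "derived_algorithm ALG E"
  let ?M = "seed (ALG E) \<Otimes>\<^sub>M random_order E"
  let ?s = "face_up E f1 f2" and ?w = "face_down E f1 f2"
  let ?sample = "\<lambda>(\<omega>, js). take (sample_length (ALG E) \<omega>) js"
  let ?is = "\<lambda>b. adv (?s b) (?w b)"
  define F where
    "F x b = weight E (?w b) (accepted (tf_accept ?A x (?s b)) (arrivals (?w b) (?is b)))" for x b
  note faces = face_in_weightings[OF f]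
  have online: "online_algorithm E \<lparr>seed = tf_seed ?A, accept = (\<lambda>x. tf_accept ?A x (?s b))\<rparr>" for b
    using tf faces by (simp add: two_faced_algorithm_def)
  have seed: "tf_seed ?A = ?M"
    by (simp add: derived_algorithm_def)
  have "(\<integral>(x, b). F x b \<partial>(?M \<Otimes>\<^sub>M measure_pmf (coins E))) =
      (\<integral>b. (\<integral>x. F x (flip (set (?sample x)) b) \<partial>?M) \<partial>measure_pmf (coins E))"
  proof (rule integral_flip_coins)
    show "prob_space ?M"
      using online by (simp add: online_algorithm_def seed)
    have "(\<lambda>(k, js). set (take k js)) \<in>
        count_space ({0..num_items E} \<times> permutations_of_set (items E)) \<rightarrow>\<^sub>M count_space (Pow (items E))"
      by (auto simp: permutations_of_set_def dest: in_set_takeD)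
    from measurable_compose[OF measurable_sample_perm[OF samp] this]
    show "(\<lambda>x. set (?sample x)) \<in> ?M \<rightarrow>\<^sub>M count_space (Pow (items E))"
      by (simp add: case_prod_unfold)
    show "(\<lambda>x. F x b) \<in> borel_measurable ?M" for b
      using measurable_weight_accepted[OF env online[of b] history_arrivals[OF faces(2)[of b]],
          of "?is b" "?w b"] adv
      by (simp add: F_def seed permutations_of_set_def)
    show "F x b = F x b'" if "\<And>i. i \<in> items E \<Longrightarrow> b i = b' i" for x b b'
      using face_cong[of E b b', OF that] by (simp add: F_def)
    show "\<bar>F x b\<bar> \<le> weight E f1 UNIV + weight E f2 UNIV" for x b
    proof -
      \<comment> \<open>Every online weight is one of the two face weights; as both are
        non-negative, it is at most their sum, whatever the coins.\<close>
      have "0 \<le> f1 i e" "0 \<le> f2 i e" if "i \<in> items E" "e \<in> item E i" for i e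
        using f that weightings_nonneg by blast+
      then have "weight E (?w b) UNIV \<le> weight E f1 UNIV + weight E f2 UNIV"
        unfolding weight_def face_down_def sum.distrib[symmetric]
        by (intro sum_mono) auto
      then show ?thesis
        using weight_nonneg[OF faces(2)] weight_le_weight_UNIV[OF env faces(2)]
        unfolding F_def by (smt (verit))
    qed
  qed
  also have "\<dots> \<ge> (\<integral>b. c * opt E (?w b) \<partial>measure_pmf (coins E))"
  proof (rule integral_mono)
    fix b
    \<comment> \<open>With \<open>b\<close> fixed, the two-faced adversary sees the faces under
      \<open>flip K b\<close>, so its order depends only on the sample set \<open>K\<close>.
      Deleting the sampled items makes it an admissible order-oblivious adversary against the fixed
      weighting \<open>?w b\<close>.\<close>
    let ?adv = "\<lambda>K. filter (\<lambda>i. i \<notin> K) (?is (flip K b))"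
    have "?adv K \<in> permutations_of_set (items E - K)" for K
      using adv by (auto simp: permutations_of_set_def)
    moreover have "\<forall>adv. (\<forall>K\<subseteq>items E. adv K \<in> permutations_of_set (items E - K)) \<longrightarrow>
        c * opt E (?w b) \<le> (\<integral>(\<omega>, js). (let sample = take (sample_length (ALG E) \<omega>) js in
          weight E (?w b) (accepted (accept (ALG E) \<omega>)
            (arrivals (?w b) (sample @ adv (set sample))))) \<partial>?M)"
      using comp faces(2)[of b] unfolding order_oblivious_competitive_on_def by blast
    ultimately have "c * opt E (?w b) \<le> (\<integral>(\<omega>, js). (let sample = take (sample_length (ALG E) \<omega>) js in
        weight E (?w b) (accepted (accept (ALG E) \<omega>)
          (arrivals (?w b) (sample @ ?adv (set sample))))) \<partial>?M)"
      by (elim allE[of _ ?adv] impE) simp_all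
    also have "\<dots> = (\<integral>x. F x (flip (set (?sample x)) b) \<partial>?M)"
      using adv by (intro Bochner_Integration.integral_cong refl)
        (auto simp: F_def Let_def space_pair_measure two_faced_run_flip[where ALG = ALG, OF env samp f])
    finally show "c * opt E (?w b) \<le> (\<integral>x. F x (flip (set (?sample x)) b) \<partial>?M)" .
  \<comment> \<open>Both sides are integrable in \<open>b\<close> because the coins have finite
    support.\<close>
  qed (auto intro!: integrable_measure_pmf_finite finite_set_pmf_coins)
  finally show "(\<integral>(x, b). (let s = ?s b; w = ?w b in
        weight E w (accepted (tf_accept ?A x s) (arrivals w (adv s w))))
      \<partial>(tf_seed ?A \<Otimes>\<^sub>M measure_pmf (coins E)))
    \<ge> c * (\<integral>b. opt E (?w b) \<partial>measure_pmf (coins E))"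
    by (simp add: F_def seed Let_def)
qed

theorem theorem4p6:
  fixes c :: real and Es :: "env set" and ALG :: "env \<Rightarrow> 'r sampling_algorithm"
  assumes "\<forall>E\<in>Es. environment E"
    and "order_oblivious_competitive c Es ALG"
  shows "two_faced_competitive c Es (derived_algorithm ALG)"
  using assms two_faced_competitive_on_derived[where ALG = ALG]
  unfolding order_oblivious_competitive_def two_faced_competitive_def by blast

end
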